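(* For every integer $j$, \[ \sum_{\substack{\lambda\in \mathcal{P}\\ |\lambda|_a=j}}\ \prod_{i\geq 1}\binom{\lambda_i-\lambda_{i+2}+1}{\lambda_{i+1}-\lambda_{i+2}}q^{\binom{\lambda_1}{2}+|\lambda|}=\frac{q^{\binom{2j}{2}}}{\prod_{i\geq 1}(1-q^{2i})^2}. \]
   Context: $\mathcal{P}$ is the set of all partitions $\lambda=(\lambda_1\ge\cdots\ge\lambda_k>0)$, with $\lambda_i=0$ for $i>k$ ($k=0$ for the empty partition), $|\lambda|=\sum\lambda_i$. The alternating sum is $|\lambda|_a=\sum_{i=1}^{\lambda_1}(-1)^{i-1}i+\sum_{i=2}^{k}(-1)^{\lambda_1+i-2}\lambda_i$, i.e. the alternating sum $1-2+3-\cdots+(-1)^{\lambda_1-1}\lambda_1+(-1)^{\lambda_1}\lambda_2+\cdots+(-1)^{\lambda_1+k-2}\lambda_k$ (equal to $0$ for the empty partition). $\binom{2j}{2}=j(2j-1)$ for any integer $j$. *)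

theory Defs
  imports "HOL-Analysis.Analysis"
begin

text \<open>
  A partition is its list of (positive, weakly decreasing) parts; the empty list is the empty
  partition and \<^term>\<open>sum_list l\<close> is the size.
\<close>

definition is_partition :: "nat list \<Rightarrow> bool" where
  "is_partition l \<longleftrightarrow> sorted_wrt (\<ge>) l \<and> (\<forall>x\<in>set l. 0 < x)"

text \<open>Parts are indexed from 1; indices beyond the length (and the unused index 0) give 0.\<close>

definition part :: "nat list \<Rightarrow> nat \<Rightarrow> nat" where
  "part l i = (if 1 \<le> i \<and> i \<le> length l then l ! (i - 1) else 0)"

definition alt_sum :: "nat list \<Rightarrow> int" where
  "alt_sum l = (\<Sum>i=1..part l 1. (- 1) ^ (i - 1) * int i)
             + (\<Sum>i=2..length l. (- 1) ^ (part l 1 + i - 2) * int (part l i))"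

text \<open>
  The natural-number subtractions do not truncate when \<open>l\<close> is a partition.
\<close>

definition binom_factor :: "nat list \<Rightarrow> nat \<Rightarrow> nat" where
  "binom_factor l i =
     (part l i - part l (i + 2) + 1) choose (part l (i + 1) - part l (i + 2))"

text \<open>
  The product over all \<open>i \<ge> 1\<close> may stop at \<open>i = length l\<close>, since all later factors are 1.
\<close>

lemma binom_factor_eq_1: "length l < i \<Longrightarrow> binom_factor l i = 1"
  by (simp add: binom_factor_def part_def)

definition binom_prod :: "nat list \<Rightarrow> nat" where
  "binom_prod l = (\<Prod>i=1..length l. binom_factor l i)"

end

theory Submission
  imports Defs
begin

text \<open>
  The numbers \<open>1, 2, ..., \<lambda>\<^sub>1, \<lambda>\<^sub>2, ..., \<lambda>\<^sub>k\<close> are read as the sizes of the successive antidiagonals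
  of a Young diagram \<open>\<mu>\<close>. Then \<open>\<mu>\<close> has \<open>(\<lambda>\<^sub>1 choose 2) + |\<lambda>|\<close> cells, and \<open>|\<lambda>|\<^sub>a\<close> is the number of
  black cells minus the number of white cells in the chessboard colouring. Drawn in the Russian
  convention inside a staircase, the boundary of \<open>\<mu>\<close> is a Dyck path (turned upside down), and the
  antidiagonal sizes amount to the number of steps of the path on each level. The number of Dyck
  paths with given level counts is a product of binomial coefficients, namely the one in the
  theorem.

  The same paths are counted by the set of positions of their down steps: the sum of the positions
  gives the number of cells, and the number of even positions gives the colour difference \<open>j\<close>.
  Separating even and odd positions leaves two independent finite sets of prescribed sizes, each of
  which contributes one factor \<open>1 / \<Prod>(1 - q\<^sup>2\<^sup>i)\<close> in the limit of large staircases.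
\<close>

section \<open>Generating functions of finite sets of naturals\<close>

text \<open>An infinite fibre would be counted as 0, so the sum and product rules below ask for
  finite fibres.\<close>

definition enum_fps :: "('a \<Rightarrow> nat) \<Rightarrow> 'a set \<Rightarrow> rat fps" where
  "enum_fps wt S = Abs_fps (\<lambda>n. of_nat (card {x\<in>S. wt x = n}))"

lemma enum_fps_nth [simp]: "fps_nth (enum_fps wt S) n = of_nat (card {x\<in>S. wt x = n})"
  by (simp add: enum_fps_def)

lemma enum_fps_bij_betw:
  assumes "bij_betw f S T" and wt: "\<And>x. x \<in> S \<Longrightarrow> wt' (f x) = wt x + c"
  shows "enum_fps wt' T = fps_X ^ c * enum_fps wt S"
proof (rule fps_ext)
  fix n
  have T: "T = f ` S" and inj: "inj_on f S"
    using assms(1) by (auto simp: bij_betw_def)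
  show "fps_nth (enum_fps wt' T) n = fps_nth (fps_X ^ c * enum_fps wt S) n"
  proof (cases "n < c")
    case True
    then have "{x\<in>T. wt' x = n} = {}"
      by (auto simp: T wt)
    then have "card {x\<in>T. wt' x = n} = 0"
      by (simp only: card.empty)
    with True show ?thesis
      by (simp add: fps_X_power_mult_nth)
  next
    case False
    then have "{x\<in>T. wt' x = n} = f ` {x\<in>S. wt x = n - c}"
      by (auto simp: T wt)
    moreover have "card (f ` {x\<in>S. wt x = n - c}) = card {x\<in>S. wt x = n - c}"
      by (rule card_image) (use inj in \<open>auto simp: inj_on_def\<close>)
    ultimately show ?thesis
      using False by (simp add: fps_X_power_mult_nth)
  qed
qed

lemma enum_fps_Un:
  assumes "S \<inter> T = {}" "\<And>n. finite {x\<in>S. wt x = n}" "\<And>n. finite {x\<in>T. wt x = n}"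
  shows "enum_fps wt (S \<union> T) = enum_fps wt S + enum_fps wt T"
proof (rule fps_ext)
  fix n
  have "{x\<in>S \<union> T. wt x = n} = {x\<in>S. wt x = n} \<union> {x\<in>T. wt x = n}"
    by auto
  then show "fps_nth (enum_fps wt (S \<union> T)) n = fps_nth (enum_fps wt S + enum_fps wt T) n"
    using assms by (simp add: card_Un_disjoint disjoint_iff)
qed

lemma enum_fps_Times:
  assumes "\<And>n. finite {x\<in>S. f x = n}" "\<And>n. finite {y\<in>T. g y = n}"
  shows "enum_fps (\<lambda>(x, y). f x + g y) (S \<times> T) = enum_fps f S * enum_fps g T"
proof (rule fps_ext)
  fix n
  have "{z\<in>S \<times> T. (case z of (x, y) \<Rightarrow> f x + g y) = n} =
      (\<Union>i\<in>{0..n}. {x\<in>S. f x = i} \<times> {y\<in>T. g y = n - i})"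
    by auto
  also have "card \<dots> = (\<Sum>i=0..n. card {x\<in>S. f x = i} * card {y\<in>T. g y = n - i})"
    using assms by (subst card_UN_disjoint) auto
  finally show "fps_nth (enum_fps (\<lambda>(x, y). f x + g y) (S \<times> T)) n
      = fps_nth (enum_fps f S * enum_fps g T) n"
    by (simp add: fps_mult_nth)
qed

text \<open>The weight is doubled because the elements will be the halves of even and of odd
  positions.\<close>

definition subsets_fps :: "nat \<Rightarrow> rat fps" where
  "subsets_fps k = enum_fps (\<lambda>A. 2 * \<Sum>A) {A. finite A \<and> card A = k}"

lemma finite_sets_sum_eq: "finite {A :: nat set. finite A \<and> 2 * \<Sum>A = n}"
proof (rule finite_subset)
  show "{A :: nat set. finite A \<and> 2 * \<Sum>A = n} \<subseteq> Pow {..n}"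
  proof safe
    fix A :: "nat set" and x assume "finite A" "x \<in> A"
    then have "x \<le> \<Sum>A" using member_le_sum[of x A "\<lambda>x. x"] by simp
    then show "x \<le> 2 * \<Sum>A" by simp
  qed
qed auto

lemma sum_Suc_image: "\<Sum>(Suc ` A) = \<Sum>A + card A"
proof (cases "finite A")
  case True
  then show ?thesis
    by (simp add: sum.reindex sum_Suc)
next
  case False
  then have "infinite (Suc ` A)" by (simp add: finite_image_iff)
  with False show ?thesis by simp
qed

lemma Suc_image_pred: "0 \<notin> A \<Longrightarrow> Suc ` {a. Suc a \<in> A} = A"
proof (rule set_eqI)
  show "x \<in> Suc ` {a. Suc a \<in> A} \<longleftrightarrow> x \<in> A" if "0 \<notin> A" for x
    using that by (cases x) auto
qed

lemma finite_pred: "finite A \<Longrightarrow> finite {a. Suc a \<in> A}"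
  using finite_vimageI[of A Suc] by (simp add: vimage_def)

lemma card_pred: "0 \<notin> A \<Longrightarrow> card {a. Suc a \<in> A} = card A"
  by (metis Suc_image_pred card_image inj_Suc)

text \<open>Split by whether 0 belongs to the set. Sets without 0 are shifts by 1 of sets of the
  same size; sets with 0 arise from shifted sets with one element fewer. Shifting \<open>k\<close>
  elements adds \<open>2 * k\<close> to the weight.\<close>

lemma subsets_fps_Suc:
  "subsets_fps (Suc k) = fps_X ^ (2 * Suc k) * subsets_fps (Suc k) + fps_X ^ (2 * k) * subsets_fps k"
proof -
  let ?wt = "\<lambda>A :: nat set. 2 * \<Sum>A"
  let ?P = "\<lambda>k. {A :: nat set. finite A \<and> card A = k}"
  let ?S = "{A \<in> ?P (Suc k). 0 \<notin> A}" and ?T = "{A \<in> ?P (Suc k). 0 \<in> A}"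
  have fin: "finite {A \<in> U. ?wt A = n}" if "U \<subseteq> {A. finite A}" for U n
    by (rule finite_subset[OF _ finite_sets_sum_eq[of n]]) (use that in auto)
  have card_Suc: "card (Suc ` A) = card A" for A
    by (rule card_image) simp
  have insert_pred: "insert 0 (Suc ` {a. Suc a \<in> A}) = A" if "0 \<in> A" for A
  proof (rule set_eqI)
    show "x \<in> insert 0 (Suc ` {a. Suc a \<in> A}) \<longleftrightarrow> x \<in> A" for x
      using that by (cases x) auto
  qed
  have "bij_betw ((`) Suc) (?P (Suc k)) ?S"
  proof (rule bij_betw_byWitness[where f' = "\<lambda>A. {a. Suc a \<in> A}"])
    show "\<forall>A\<in>?S. Suc ` {a. Suc a \<in> A} = A"
      using Suc_image_pred by blast
    show "(`) Suc ` ?P (Suc k) \<subseteq> ?S"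
      by (auto simp: card_Suc)
    show "(\<lambda>A. {a. Suc a \<in> A}) ` ?S \<subseteq> ?P (Suc k)"
      by (auto simp: finite_pred card_pred)
  qed auto
  then have S: "enum_fps ?wt ?S = fps_X ^ (2 * Suc k) * enum_fps ?wt (?P (Suc k))"
    by (rule enum_fps_bij_betw) (clarsimp simp: sum_Suc_image)
  have "bij_betw (\<lambda>A. insert 0 (Suc ` A)) (?P k) ?T"
  proof (rule bij_betw_byWitness[where f' = "\<lambda>A. {a. Suc a \<in> A}"])
    show "\<forall>A\<in>?T. insert 0 (Suc ` {a. Suc a \<in> A}) = A"
      using insert_pred by blast
    show "(\<lambda>A. insert 0 (Suc ` A)) ` ?P k \<subseteq> ?T"
      using card_Suc by (auto simp: card_insert_if)
    show "(\<lambda>A. {a. Suc a \<in> A}) ` ?T \<subseteq> ?P k"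
    proof safe
      fix A :: "nat set" assume A: "finite A" "card A = Suc k" "0 \<in> A"
      then show "finite {a. Suc a \<in> A}" by (simp add: finite_pred)
      from A have "card (insert 0 (Suc ` {a. Suc a \<in> A})) = Suc k"
        by (simp only: insert_pred)
      moreover have "finite (Suc ` {a. Suc a \<in> A})" "0 \<notin> Suc ` {a. Suc a \<in> A}"
        using finite_pred[OF A(1)] by auto
      ultimately show "card {a. Suc a \<in> A} = k"
        by (metis card_insert_disjoint card_Suc nat.inject)
    qed
  qed auto
  then have T: "enum_fps ?wt ?T = fps_X ^ (2 * k) * enum_fps ?wt (?P k)"
    by (rule enum_fps_bij_betw) (clarsimp simp: sum_Suc_image)
  have "?P (Suc k) = ?S \<union> ?T" by auto
  then have "enum_fps ?wt (?P (Suc k)) = enum_fps ?wt (?S \<union> ?T)" by (rule arg_cong[where f = "enum_fps ?wt"])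
  also have "\<dots> = enum_fps ?wt ?S + enum_fps ?wt ?T"
    by (rule enum_fps_Un[OF _ fin fin]) auto
  finally show ?thesis
    unfolding S T subsets_fps_def .
qed

definition euler_fps :: "nat \<Rightarrow> rat fps" where
  "euler_fps k = (\<Prod>i<k. 1 - fps_X ^ (2 * (i + 1)))"

text \<open>Moving both terms in \<open>subsets_fps (Suc k)\<close> to one side of the recursion
  produces the next factor of the product. The exponent is the weight of the smallest set
  \<open>{0..<k}\<close>.\<close>

lemma subsets_fps_mult_euler: "subsets_fps k * euler_fps k = fps_X ^ (k * (k - 1))"
proof (induction k)
  case 0
  have "{A :: nat set. finite A \<and> card A = 0 \<and> 2 * \<Sum>A = n} = (if n = 0 then {{}} else {})" for n
    by auto
  then show ?case
    by (intro fps_ext) (auto simp: subsets_fps_def euler_fps_def card_eq_0_iff)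
next
  case (Suc k)
  let ?q = "fps_X ^ (2 * Suc k) :: rat fps"
  have "subsets_fps (Suc k) * euler_fps (Suc k)
      = (subsets_fps (Suc k) - ?q * subsets_fps (Suc k)) * euler_fps k"
    by (simp add: euler_fps_def algebra_simps del: power_Suc)
  also have "subsets_fps (Suc k) - ?q * subsets_fps (Suc k) = fps_X ^ (2 * k) * subsets_fps k"
    using subsets_fps_Suc[of k] by (metis add_diff_cancel_left')
  also have "fps_X ^ (2 * k) * subsets_fps k * euler_fps k = fps_X ^ (2 * k) * fps_X ^ (k * (k - 1))"
    by (simp only: Suc mult.assoc)
  also have "\<dots> = fps_X ^ (2 * k + k * (k - 1))"
    by (simp only: power_add)
  also have "2 * k + k * (k - 1) = Suc k * (Suc k - 1)"
    by (cases k) (auto simp: algebra_simps)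
  finally show ?case .
qed

section \<open>Power series modulo a power of the variable, and the infinite product\<close>

definition fps_agree :: "nat \<Rightarrow> 'a :: zero fps \<Rightarrow> 'a fps \<Rightarrow> bool" where
  "fps_agree n f g \<longleftrightarrow> (\<forall>i\<le>n. fps_nth f i = fps_nth g i)"

lemma fps_agree_mult:
  assumes "fps_agree n f g" "fps_agree n f' g'"
  shows "fps_agree n (f * f') (g * g')"
  using assms by (auto simp: fps_agree_def fps_mult_nth intro!: sum.cong)

lemma fps_agree_inverse:
  fixes f g :: "'a :: field fps"
  assumes "fps_agree n f g" "fps_nth f 0 \<noteq> 0"
  shows "fps_agree n (inverse f) (inverse g)"
proof -
  have "fps_nth g 0 \<noteq> 0" using assms by (auto simp: fps_agree_def)
  have "fps_agree n (inverse f * (g * inverse g)) (inverse f * (f * inverse g))"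
    using assms(1) by (intro fps_agree_mult) (auto simp: fps_agree_def)
  then show ?thesis
    using assms(2) \<open>fps_nth g 0 \<noteq> 0\<close>
    by (simp add: inverse_mult_eq_1 inverse_mult_eq_1' flip: mult.assoc)
qed

text \<open>Each factor that \<open>euler_fps l\<close> has in addition is 1 modulo
  \<open>fps_X ^ (2 * (k + 1))\<close>.\<close>

lemma euler_fps_agree: "n < 2 * (k + 1) \<Longrightarrow> k \<le> l \<Longrightarrow> fps_agree n (euler_fps l) (euler_fps k)"
proof (induction l)
  case (Suc l)
  show ?case
  proof (cases "k = Suc l")
    case False
    have "fps_agree n (1 - fps_X ^ (2 * (l + 1))) (1 :: rat fps)"
      using Suc.prems False by (auto simp: fps_agree_def)
    from fps_agree_mult[OF Suc.IH this] show ?thesis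
      using Suc.prems False by (simp add: euler_fps_def)
  qed (auto simp: fps_agree_def)
qed (auto simp: fps_agree_def)

lemma euler_fps_nth_0 [simp]: "fps_nth (euler_fps k) 0 = 1"
  by (induction k) (auto simp: euler_fps_def)

text \<open>Coefficient \<open>n\<close> is read off from the \<open>n\<close>-th partial product,
  where it has already stabilised.\<close>

definition euler_inf_fps :: "rat fps" where
  "euler_inf_fps = Abs_fps (\<lambda>n. fps_nth (euler_fps n) n)"

lemma euler_inf_fps_agree: "n \<le> k \<Longrightarrow> fps_agree n euler_inf_fps (euler_fps k)"
  unfolding fps_agree_def
proof safe
  fix i assume "n \<le> k" "i \<le> n"
  then have "fps_agree i (euler_fps k) (euler_fps i)"
    by (intro euler_fps_agree) auto
  then show "fps_nth euler_inf_fps i = fps_nth (euler_fps k) i"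
    by (simp add: euler_inf_fps_def fps_agree_def)
qed

lemma euler_inf_fps_nth_0: "fps_nth euler_inf_fps 0 = 1"
  by (simp add: euler_inf_fps_def)

lemma prodinf_euler_squared:
  "(\<Prod>i. (1 - fps_X ^ (2 * (i + 1))) ^ 2) = (euler_inf_fps ^ 2 :: rat fps)"
proof (rule has_prod_unique[symmetric])
  have "(\<lambda>n. \<Prod>i\<le>n. (1 - fps_X ^ (2 * (i + 1))) ^ 2) \<longlonglongrightarrow> euler_inf_fps ^ 2"
  proof (rule tendsto_fpsI)
    fix n
    have "fps_nth (\<Prod>i\<le>k. (1 - fps_X ^ (2 * (i + 1))) ^ 2) n = fps_nth (euler_inf_fps ^ 2) n"
      if "n \<le> k" for k
    proof -
      have "fps_agree n (euler_inf_fps * euler_inf_fps) (euler_fps (Suc k) * euler_fps (Suc k))"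
        using that by (intro fps_agree_mult euler_inf_fps_agree) auto
      moreover have "(\<Prod>i\<le>k. (1 - fps_X ^ (2 * (i + 1))) ^ 2) = euler_fps (Suc k) ^ 2"
        by (simp only: euler_fps_def prod_power_distrib lessThan_Suc_atMost)
      ultimately show ?thesis
        by (simp add: fps_agree_def power2_eq_square)
    qed
    then show "\<forall>\<^sub>F k in sequentially. fps_nth (\<Prod>i\<le>k. (1 - fps_X ^ (2 * (i + 1))) ^ 2) n
        = fps_nth (euler_inf_fps ^ 2) n"
      unfolding eventually_sequentially by blast
  qed
  \<comment> \<open>A product convergent from index 0 must have a nonzero limit.\<close>
  moreover have "euler_inf_fps \<noteq> 0"
    using euler_inf_fps_nth_0 by auto
  ultimately show "(\<lambda>i. (1 - fps_X ^ (2 * (i + 1))) ^ 2) has_prod (euler_inf_fps ^ 2)"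
    by (simp add: has_prod_def raw_has_prod_def)
qed

section \<open>Dyck words with prescribed level counts\<close>

text \<open>
  \<^term>\<open>True\<close> is a down step, increasing the depth, and \<^term>\<open>False\<close> an up step. Words start at depth
  \<open>d\<close> and have to end at depth 0.
\<close>

fun dyck_from :: "nat \<Rightarrow> bool list \<Rightarrow> bool" where
  "dyck_from d [] \<longleftrightarrow> d = 0"
| "dyck_from d (True # w) \<longleftrightarrow> dyck_from (Suc d) w"
| "dyck_from d (False # w) \<longleftrightarrow> d > 0 \<and> dyck_from (d - 1) w"

text \<open>The value at \<open>i\<close> is the number of down steps that leave depth
  \<open>i\<close>.\<close>

fun down_steps :: "nat \<Rightarrow> bool list \<Rightarrow> nat \<Rightarrow> nat" where
  "down_steps d [] = (\<lambda>_. 0)"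
| "down_steps d (True # w) = (down_steps (Suc d) w)(d := Suc (down_steps (Suc d) w d))"
| "down_steps d (False # w) = down_steps (d - 1) w"

definition words :: "nat \<Rightarrow> (nat \<Rightarrow> nat) \<Rightarrow> bool list set" where
  "words d e = {w. dyck_from d w \<and> down_steps d w = e}"

text \<open>
  The number of ways to interleave the \<open>e i\<close> down steps and the up steps that leave depth \<open>i\<close>. There
  are \<open>e (i - 1)\<close> such up steps, and one more if \<open>i \<le> d\<close>; the last exit has to be an up step. If
  there are none, the subtraction truncates and the factor is 0 unless \<open>e i = 0\<close>, as it should be.
\<close>

definition level_factor :: "nat \<Rightarrow> (nat \<Rightarrow> nat) \<Rightarrow> nat \<Rightarrow> nat" where
  "level_factor d e i = (e i + e (i - 1) + (if i \<le> d then 1 else 0) - 1) choose e i"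

text \<open>Case distinction on the first step. The assumption rules out the empty word, and a down
  step uses up one unit of \<open>e d\<close>.\<close>

lemma words_rec:
  assumes "d > 0 \<or> (\<exists>i. e i > 0)"
  shows "words d e = (if e d > 0 then (#) True ` words (Suc d) (e(d := e d - 1)) else {})
      \<union> (if d > 0 then (#) False ` words (d - 1) e else {})"
proof (rule set_eqI)
  fix w
  show "w \<in> words d e \<longleftrightarrow> w \<in> (if e d > 0 then (#) True ` words (Suc d) (e(d := e d - 1)) else {})
      \<union> (if d > 0 then (#) False ` words (d - 1) e else {})"
  proof (cases w)
    case Nil
    with assms show ?thesis by (auto simp: words_def)
  next
    case (Cons b v)
    have "down_steps d (True # v) = e \<longleftrightarrow> e d > 0 \<and> down_steps (Suc d) v = e(d := e d - 1)"
      by (auto simp: fun_eq_iff)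
    with Cons show ?thesis
      by (cases b) (auto simp: words_def)
  qed
qed

text \<open>Pascal's rule: the summands count the interleavings at level \<open>d\<close> that begin
  with a down step and with an up step.\<close>

lemma level_factor_pascal:
  assumes "d > 0"
  shows "level_factor d e d
    = (if e d > 0 then level_factor (Suc d) (e(d := e d - 1)) d else 0) + level_factor (d - 1) e d"
proof (cases "e d")
  case (Suc k)
  then show ?thesis
    using assms by (cases "e (d - 1)") (auto simp: level_factor_def)
qed (use assms in \<open>auto simp: level_factor_def\<close>)

text \<open>The induction measure is the common length of the words. The product starts at level 1
  because only down steps leave depth 0, so there is nothing to interleave.\<close>

lemma card_words:
  assumes "\<And>i. i \<ge> K \<Longrightarrow> e i = 0" "d \<le> K"
  shows "finite (words d e) \<and> card (words d e) = (\<Prod>i=1..K. level_factor d e i)"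
  using assms
proof (induction "2 * (\<Sum>i<K. e i) + d" arbitrary: d e rule: less_induct)
  case less
  define e' where "e' = e(d := e d - 1)"
  consider (empty) "d = 0" "\<And>i. e i = 0" | (stuck) "d = 0" "e 0 = 0" "\<exists>i. e i > 0"
    | (bottom) "d = 0" "e 0 > 0" | (step) "d > 0"
    by (metis neq0_conv)
  then show ?case
  proof cases
    case empty
    have "w = []" if "down_steps 0 w = e" "dyck_from 0 w" for w
    proof (cases w)
      case (Cons b v)
      with that have b by (cases b) auto
      then have "down_steps 0 w 0 > 0" using Cons by simp
      with that empty show ?thesis by simp
    qed
    then have "words d e = {[]}"
      using empty by (auto simp: words_def)
    moreover have "level_factor d e i = 1" for i
      using empty by (simp add: level_factor_def)
    ultimately show ?thesis by simp
  next
    \<comment> \<open>The path is confined to depth 0 while deeper down steps remain, so no word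
      exists. At the least level with \<open>e i > 0\<close> the factor is
      \<open>(e i - 1) choose e i\<close>, which is 0.\<close>
    case stuck
    define i where "i = (LEAST i. e i > 0)"
    have i: "e i > 0"
      using stuck(3) unfolding i_def by (rule LeastI_ex)
    then have "i > 0" using stuck by (cases i) auto
    then have "e (i - 1) = 0"
      using not_less_Least[of "i - 1" "\<lambda>i. e i > 0"] by (auto simp: i_def)
    then have "level_factor d e i = 0"
      using i stuck \<open>i > 0\<close> by (simp add: level_factor_def)
    moreover have "i \<in> {1..K}"
      using i \<open>i > 0\<close> less.prems(1)[of i] by (cases "i \<ge> K") auto
    ultimately have "(\<Prod>i=1..K. level_factor d e i) = 0"
      by (auto intro!: prod_zero)
    moreover have "words d e = {}"
      using stuck by (subst words_rec) auto
    ultimately show ?thesis by simp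
  next
    case bottom
    have "K > 0" using bottom(2) less.prems(1)[of 0] by (cases K) auto
    have "(\<Sum>i<K. e i) = Suc (\<Sum>i<K. e' i)"
      using bottom \<open>K > 0\<close> unfolding e'_def
      by (simp add: sum.remove[of "{..<K}" 0])
    then have IH: "finite (words 1 e')" "card (words 1 e') = (\<Prod>i=1..K. level_factor 1 e' i)"
      using less.hyps[of e' 1] less.prems bottom \<open>K > 0\<close> by (auto simp: e'_def)
    have words: "words d e = (#) True ` words 1 e'"
      using bottom by (subst words_rec) (auto simp: e'_def)
    \<comment> \<open>At level 1 the unit lost in \<open>e 0\<close> is made up by the pending up
      step from the new depth 1.\<close>
    have "level_factor 1 e' i = level_factor d e i" if "i \<ge> 1" for i
      using that bottom by (auto simp: level_factor_def e'_def)
    then show ?thesis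
      using IH by (simp add: words card_image)
  next
    case step
    \<comment> \<open>Either first step changes only the factor of level \<open>d\<close>, so
      \<open>?R\<close> is common to both branches.\<close>
    let ?R = "\<Prod>i\<in>{1..K} - {d}. level_factor d e i"
    have d: "d \<in> {1..K}" using step less.prems by auto
    have down: "finite (words (Suc d) e')"
        "card (words (Suc d) e') = level_factor (Suc d) e' d * ?R" if "e d > 0"
    proof -
      have "d < K" using that less.prems(1)[of d] by (cases "d < K") auto
      then have "(\<Sum>i<K. e i) = Suc (\<Sum>i<K. e' i)"
        using that unfolding e'_def by (simp add: sum.remove[of "{..<K}" d])
      then have IH: "finite (words (Suc d) e')"
          "card (words (Suc d) e') = (\<Prod>i=1..K. level_factor (Suc d) e' i)"
        using less.hyps[of e' "Suc d"] less.prems \<open>d < K\<close> by (auto simp: e'_def)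
      have "level_factor (Suc d) e' i = level_factor d e i" if "i \<noteq> d" "i \<ge> 1" for i
        using that \<open>e d > 0\<close> by (auto simp: level_factor_def e'_def)
      then have "(\<Prod>i\<in>{1..K} - {d}. level_factor (Suc d) e' i) = ?R"
        by (intro prod.cong) auto
      then show "finite (words (Suc d) e')"
        "card (words (Suc d) e') = level_factor (Suc d) e' d * ?R"
        using IH d by (simp_all add: prod.remove[of _ d])
    qed
    have up: "finite (words (d - 1) e)" "card (words (d - 1) e) = level_factor (d - 1) e d * ?R"
    proof -
      have IH: "finite (words (d - 1) e)"
          "card (words (d - 1) e) = (\<Prod>i=1..K. level_factor (d - 1) e i)"
        using less.hyps[of e "d - 1"] less.prems step by auto
      have "level_factor (d - 1) e i = level_factor d e i" if "i \<noteq> d" for i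
        using that by (auto simp: level_factor_def)
      then have "(\<Prod>i\<in>{1..K} - {d}. level_factor (d - 1) e i) = ?R"
        by (intro prod.cong) auto
      then show "finite (words (d - 1) e)" "card (words (d - 1) e) = level_factor (d - 1) e d * ?R"
        using IH d by (simp_all add: prod.remove[of _ d])
    qed
    have rec: "words d e = (if e d > 0 then (#) True ` words (Suc d) e' else {})
        \<union> (#) False ` words (d - 1) e"
      using words_rec[of d e] step by (simp add: e'_def)
    have "card (words d e)
        = (if e d > 0 then card (words (Suc d) e') else 0) + card (words (d - 1) e)"
      unfolding rec using down(1) up(1)
      by (subst card_Un_disjoint) (auto simp: card_image)
    also have "\<dots> = level_factor d e d * ?R"
      using down(2) up(2) level_factor_pascal[OF step, of e]
      by (auto simp: e'_def algebra_simps)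
    finally have "card (words d e) = (\<Prod>i=1..K. level_factor d e i)"
      using d by (simp add: prod.remove[of _ d])
    moreover have "finite (words d e)"
      unfolding rec using down(1) up(1) by simp
    ultimately show ?thesis by simp
  qed
qed

section \<open>Statistics of words in terms of the positions of down steps\<close>

definition positions :: "bool list \<Rightarrow> nat set" where
  "positions w = {i. i < length w \<and> w ! i}"

lemma positions_Nil [simp]: "positions [] = {}"
  by (simp add: positions_def)

lemma finite_positions [simp]: "finite (positions w)"
  by (simp add: positions_def)

lemma positions_False [simp]: "positions (False # w) = Suc ` positions w"
proof (rule set_eqI)
  show "i \<in> positions (False # w) \<longleftrightarrow> i \<in> Suc ` positions w" for i
    by (cases i) (auto simp: positions_def)
qed

lemma positions_True [simp]: "positions (True # w) = insert 0 (Suc ` positions w)"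
proof (rule set_eqI)
  show "i \<in> positions (True # w) \<longleftrightarrow> i \<in> insert 0 (Suc ` positions w)" for i
    by (cases i) (auto simp: positions_def)
qed

lemma down_steps_eq_0: "i \<ge> d + length w \<Longrightarrow> down_steps d w i = 0"
  by (induction d w rule: down_steps.induct) auto

text \<open>The path starts at depth at most \<open>i\<close> and moves by one level at a time, so
  it reaches depth \<open>Suc i\<close> only by a down step from \<open>i\<close>.\<close>

lemma down_steps_connected:
  assumes "dyck_from d w" "i \<ge> d" "down_steps d w (Suc i) > 0"
  shows "down_steps d w i > 0"
  using assms
proof (induction d w rule: down_steps.induct)
  case (2 d w)
  show ?case
  proof (cases "i = d")
    case False
    have "down_steps (Suc d) w i > 0"
      by (rule "2.IH") (use "2.prems" False in auto)
    with False show ?thesis by simp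
  qed simp
next
  case (3 d w)
  have "down_steps (d - 1) w i > 0"
    by (rule "3.IH") (use "3.prems" in auto)
  then show ?case by simp
qed simp

text \<open>A down step at position \<open>p\<close> from depth \<open>t\<close>, preceded by
  \<open>k\<close> down steps, satisfies \<open>p + t = 2 * k + d\<close>. Modulo 2 this is the
  third claim; summed over all down steps it is the fourth. All four claims go through one induction
  on the word.\<close>

lemma length_dyck:
  assumes "dyck_from d w" "K \<ge> d + length w"
  shows "length w = 2 * (\<Sum>i<K. down_steps d w i) + d"
    and "card (positions w) = (\<Sum>i<K. down_steps d w i)"
    and "card {i\<in>positions w. even (i + d)} = (\<Sum>i | i < K \<and> even i. down_steps d w i)"
    and "\<Sum>(positions w) + (\<Sum>i<K. i * down_steps d w i) + card (positions w)
      = card (positions w) ^ 2 + d * card (positions w)"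
proof -
  have "length w = 2 * (\<Sum>i<K. down_steps d w i) + d \<and> 
    card (positions w) = (\<Sum>i<K. down_steps d w i) \<and>
    card {i\<in>positions w. even (i + d)} = (\<Sum>i | i < K \<and> even i. down_steps d w i) \<and>
    \<Sum>(positions w) + (\<Sum>i<K. i * down_steps d w i) + card (positions w)
      = card (positions w) ^ 2 + d * card (positions w)"
    using assms
  proof (induction d w rule: down_steps.induct)
    case (2 d w)
    let ?e = "down_steps (Suc d) w" and ?e' = "down_steps d (True # w)"
    have "d < K" using "2.prems" by simp
    have pr: "dyck_from (Suc d) w" "Suc d + length w \<le> K"
      using "2.prems" by auto
    from "2.IH"[OF pr] have IH1: "length w = 2 * (\<Sum>i<K. down_steps (Suc d) w i) + Suc d"
      and IH2: "card (positions w) = (\<Sum>i<K. down_steps (Suc d) w i)"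
      and IH3: "card {i\<in>positions w. even (i + Suc d)} = (\<Sum>i | i < K \<and> even i. down_steps (Suc d) w i)"
      and IH4: "\<Sum>(positions w) + (\<Sum>i<K. i * down_steps (Suc d) w i) + card (positions w)
        = card (positions w) ^ 2 + Suc d * card (positions w)"
      by blast+
    have e: "?e' i = ?e i + (if i = d then 1 else 0)" for i by simp
    have s1: "(\<Sum>i<K. ?e' i) = Suc (\<Sum>i<K. ?e i)"
      unfolding e using \<open>d < K\<close> by (simp add: sum.distrib)
    have ie: "i * ?e' i = i * ?e i + (if i = d then d else 0)" for i by simp
    have s2: "(\<Sum>i<K. i * ?e' i) = (\<Sum>i<K. i * ?e i) + d"
      unfolding ie using \<open>d < K\<close> by (simp add: sum.distrib)
    have s3: "(\<Sum>i | i < K \<and> even i. ?e' i) = (\<Sum>i | i < K \<and> even i. ?e i) + (if even d then 1 else 0)"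
      unfolding e using \<open>d < K\<close> by (simp add: sum.distrib)
    have c: "card (positions (True # w)) = Suc (card (positions w))"
      by (simp add: card_image card_insert_if)
    have p: "\<Sum>(positions (True # w)) = \<Sum>(positions w) + card (positions w)"
      by (simp add: sum.reindex sum_Suc)
    have "{i\<in>positions (True # w). even (i + d)}
        = (if even d then {0} else {}) \<union> Suc ` {i\<in>positions w. even (i + Suc d)}"
      by auto
    then have q: "card {i\<in>positions (True # w). even (i + d)}
        = (if even d then 1 else 0) + card {i\<in>positions w. even (i + Suc d)}"
      by (auto simp: card_image card_insert_if)
    show ?case
    proof (intro conjI)
      show "length (True # w) = 2 * (\<Sum>i<K. ?e' i) + d"
        unfolding s1 using IH1 by simp
      show "card (positions (True # w)) = (\<Sum>i<K. ?e' i)"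
        unfolding s1 c IH2 ..
      show "card {i\<in>positions (True # w). even (i + d)} = (\<Sum>i | i < K \<and> even i. ?e' i)"
        unfolding s3 q IH3 by simp
      show "\<Sum>(positions (True # w)) + (\<Sum>i<K. i * ?e' i) + card (positions (True # w))
        = card (positions (True # w)) ^ 2 + d * card (positions (True # w))"
        unfolding p c s2 using IH4 by (simp add: power2_eq_square)
    qed
  next
    case (3 d w)
    have pr: "dyck_from (d - 1) w" "d - 1 + length w \<le> K"
      using "3.prems" by auto
    from "3.IH"[OF pr] have IH1: "length w = 2 * (\<Sum>i<K. down_steps (d - 1) w i) + (d - 1)"
      and IH2: "card (positions w) = (\<Sum>i<K. down_steps (d - 1) w i)"
      and IH3: "card {i\<in>positions w. even (i + (d - 1))} = (\<Sum>i | i < K \<and> even i. down_steps (d - 1) w i)"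
      and IH4: "\<Sum>(positions w) + (\<Sum>i<K. i * down_steps (d - 1) w i) + card (positions w)
        = card (positions w) ^ 2 + (d - 1) * card (positions w)"
      by blast+
    have p: "\<Sum>(positions (False # w)) = \<Sum>(positions w) + card (positions w)"
      by (simp add: sum.reindex sum_Suc)
    have c: "card (positions (False # w)) = card (positions w)"
      by (simp add: card_image)
    have "d > 0" using "3.prems" by simp
    then have "{i\<in>positions (False # w). even (i + d)} = Suc ` {i\<in>positions w. even (i + (d - 1))}"
      by auto
    then have q: "card {i\<in>positions (False # w). even (i + d)} = card {i\<in>positions w. even (i + (d - 1))}"
      by (simp add: card_image)
    show ?case
      unfolding p c q down_steps.simps
    proof (intro conjI)
      show "length (False # w) = 2 * (\<Sum>i<K. down_steps (d - 1) w i) + d"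
        using IH1 \<open>d > 0\<close> by simp
      show "\<Sum>(positions w) + card (positions w) + (\<Sum>i<K. i * down_steps (d - 1) w i) + card (positions w)
        = card (positions w) ^ 2 + d * card (positions w)"
        using IH4 \<open>d > 0\<close> by (cases d) simp_all
    qed (fact IH2 IH3)+
  qed simp
  then show "length w = 2 * (\<Sum>i<K. down_steps d w i) + d"
    and "card (positions w) = (\<Sum>i<K. down_steps d w i)"
    and "card {i\<in>positions w. even (i + d)} = (\<Sum>i | i < K \<and> even i. down_steps d w i)"
    and "\<Sum>(positions w) + (\<Sum>i<K. i * down_steps d w i) + card (positions w)
      = card (positions w) ^ 2 + d * card (positions w)"
    by auto
qed

text \<open>The minimum is attained by \<open>{0..<card A}\<close>: the largest element is at least
  the number of the others.\<close>

lemma sum_nat_set_ge: "finite A \<Longrightarrow> card A * (card A - 1) \<le> 2 * \<Sum>(A :: nat set)"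
proof (induction A rule: finite_linorder_max_induct)
  case (insert b A)
  then have "A \<subseteq> {..<b}" by auto
  then have "card A \<le> b" using card_mono[of "{..<b}" A] by simp
  moreover have "b \<notin> A" using insert by auto
  ultimately show ?case
    using insert by (cases "card A") auto
qed simp

text \<open>
  A balanced word that leaves the region of nonnegative depths encodes a partition with many cells.
  Hence all balanced words that encode small partitions are Dyck words.
\<close>

lemma dyck_or_large:
  assumes "length w = 2 * card (positions w) + d" "\<not> dyck_from d w"
  shows "card (positions w) > 0 \<and> 2 * \<Sum>(positions w)
    \<ge> card (positions w) * (card (positions w) - 1) + 2 * card (positions w) + 2 * d"
  using assms
proof (induction d w rule: down_steps.induct)
  case (2 d w)
  have c: "card (positions (True # w)) = Suc (card (positions w))"
    by (simp add: card_image card_insert_if)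
  have p: "\<Sum>(positions (True # w)) = \<Sum>(positions w) + card (positions w)"
    by (simp add: sum.reindex sum_Suc)
  have "card (positions w) > 0 \<and> 2 * \<Sum>(positions w)
    \<ge> card (positions w) * (card (positions w) - 1) + 2 * card (positions w) + 2 * Suc d"
    using 2 c by auto
  then show ?case
    unfolding c p by (cases "card (positions w)") auto
next
  case (3 d w)
  have p: "\<Sum>(positions (False # w)) = \<Sum>(positions w) + card (positions w)"
    by (simp add: sum.reindex sum_Suc)
  have c: "card (positions (False # w)) = card (positions w)"
    by (simp add: card_image)
  define D where "D = card (positions w)"
  show ?case
  proof (cases "d = 0")
    \<comment> \<open>Here the path leaves the region. The positions in the rest are only known to
      have at least the minimal sum; this up step moves each of them by one, which adds
      \<open>2 * D\<close> to the doubled sum.\<close>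
    case True
    with 3 c have "D > 0" by (cases D) (auto simp: D_def)
    have "2 * \<Sum>(positions w) \<ge> D * (D - 1)"
      unfolding D_def by (rule sum_nat_set_ge) simp
    with True \<open>D > 0\<close> show ?thesis
      unfolding p c D_def[symmetric] by simp
  next
    case False
    then have "D > 0 \<and> 2 * \<Sum>(positions w) \<ge> D * (D - 1) + 2 * D + 2 * (d - 1)"
      using 3 c by (auto simp: D_def)
    then show ?thesis
      unfolding p c D_def[symmetric] using False by (cases D) auto
  qed
qed auto

section \<open>Partitions as level counts\<close>

lemma part_0_iff: "is_partition l \<Longrightarrow> i \<ge> 1 \<Longrightarrow> part l i = 0 \<longleftrightarrow> i > length l"
  by (auto simp: is_partition_def part_def Suc_le_eq)

lemma choose_two_add: "(a + b) choose 2 = (a choose 2) + (b choose 2) + a * b"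
  by (induction a) (auto simp: numeral_2_eq_2 algebra_simps)

lemma part_beyond: "i > length l \<Longrightarrow> part l i = 0"
  by (simp add: part_def)

lemma part_antimono: "is_partition l \<Longrightarrow> 1 \<le> i \<Longrightarrow> i \<le> k \<Longrightarrow> part l k \<le> part l i"
  using sorted_wrt_nth_less[of "(\<ge>)" l "i - 1" "k - 1"]
  by (cases "i = k") (auto simp: is_partition_def part_def)

lemma sum_list_part:
  assumes "length l \<le> r"
  shows "sum_list l = (\<Sum>i=1..r. part l i)"
proof -
  have "sum_list l = (\<Sum>i<length l. l ! i)"
    by (simp add: sum_list_sum_nth atLeast0LessThan)
  also have "\<dots> = (\<Sum>i=1..length l. part l i)"
    by (rule sum.reindex_bij_witness[of _ "\<lambda>i. i - 1" Suc]) (auto simp: part_def)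
  also have "\<dots> = (\<Sum>i=1..r. part l i)"
    using assms by (intro sum.mono_neutral_left) (auto simp: part_def)
  finally show ?thesis .
qed

lemma partition_eqI:
  assumes "is_partition k" "is_partition l" "\<And>i. i \<ge> 1 \<Longrightarrow> part k i = part l i"
  shows "k = l"
proof (rule nth_equalityI)
  have "i > length k \<longleftrightarrow> i > length l" if "i \<ge> 1" for i
    using assms that part_0_iff by metis
  from this[of "Suc (length k)"] this[of "Suc (length l)"] show len: "length k = length l"
    by simp
  show "k ! i = l ! i" if "i < length k" for i
    using assms(3)[of "Suc i"] that len by (simp add: part_def)
qed

lemma partition_exists:
  assumes "\<And>i. i \<ge> 1 \<Longrightarrow> p (Suc i) \<le> p i" "p (Suc r) = 0"
  obtains l where "is_partition l" "length l \<le> r" "\<And>i. i \<ge> 1 \<Longrightarrow> part l i = p i"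
proof -
  \<comment> \<open>By monotonicity \<open>p\<close> vanishes from its first zero on, so that zero
    marks the length.\<close>
  define k where "k = (LEAST k. p (Suc k) = 0)"
  have k: "p (Suc k) = 0" "k \<le> r"
    using assms(2) unfolding k_def by (auto intro: LeastI Least_le)
  have pos: "p (Suc i) > 0" if "i < k" for i
    using not_less_Least[of i "\<lambda>k. p (Suc k) = 0"] that by (auto simp: k_def)
  have anti: "p (Suc j) \<le> p (Suc i)" if "i \<le> j" for i j
    using lift_Suc_antimono_le[of "\<lambda>i. p (Suc i)"] assms(1) that by auto
  define l where "l = map (\<lambda>i. p (Suc i)) [0..<k]"
  show ?thesis
  proof
    show "is_partition l"
      unfolding is_partition_def l_def
      by (auto simp: sorted_wrt_map sorted_wrt_iff_nth_less pos anti)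
    show "length l \<le> r" using k by (simp add: l_def)
    show "part l i = p i" if "i \<ge> 1" for i
    proof (cases "i \<le> k")
      case True
      with that show ?thesis by (cases i) (simp_all add: part_def l_def)
    next
      case False
      then have "p (Suc (i - 1)) \<le> p (Suc k)" by (intro anti) auto
      with False that k show ?thesis by (simp add: part_def l_def)
    qed
  qed
qed

text \<open>
  With \<open>a\<^sub>h\<close> cells on the \<open>h\<close>-th antidiagonal, the boundary path has \<open>1 + a\<^sub>h - a\<^sub>h\<^sub>+\<^sub>1\<close> down steps from
  height \<open>h + 1\<close> to \<open>h\<close>. Depth \<open>t\<close> is height \<open>N - t\<close>, and the antidiagonal of size \<open>part l i\<close> has
  number \<open>part l 1 + i - 1\<close>.
\<close>

definition level_counts :: "nat \<Rightarrow> nat list \<Rightarrow> nat \<Rightarrow> nat" where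
  "level_counts N l t = (let r = N - part l 1 in
     if t < r then 1 + part l (r - t) - part l (r - t + 1) else 0)"

definition partitions_upto :: "nat \<Rightarrow> nat list set" where
  "partitions_upto N = {l. is_partition l \<and> part l 1 + length l \<le> N}"

context
  fixes N l r e
  assumes l: "l \<in> partitions_upto N"
  defines "r \<equiv> N - part l 1" and "e \<equiv> level_counts N l"
begin

lemma length_le_r: "length l \<le> r" and r_plus: "r + part l 1 = N"
  using l by (auto simp: partitions_upto_def r_def)

lemma is_partition_l: "is_partition l"
  using l by (simp add: partitions_upto_def)

lemma level_counts_eq: "e t = (if t < r then 1 + part l (r - t) - part l (r - t + 1) else 0)"
  by (simp only: e_def level_counts_def r_def Let_def)

text \<open>The support of \<open>e\<close> thus determines \<open>r\<close>, and with it the first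
  part.\<close>

lemma level_counts_pos_iff: "e t > 0 \<longleftrightarrow> t < r"
  using part_antimono[OF is_partition_l, of "r - t" "r - t + 1"]
  by (cases "t < r") (auto simp: level_counts_eq Suc_le_eq)

lemma level_counts_beyond: "t \<ge> r \<Longrightarrow> e t = 0"
  by (simp add: level_counts_eq)

lemma level_counts_add:
  assumes "t < r"
  shows "e t + part l (r - t + 1) = 1 + part l (r - t)"
  using part_antimono[OF is_partition_l, of "r - t" "r - t + 1"] assms
  by (auto simp: level_counts_eq Suc_le_eq)

text \<open>The sum telescopes, starting from \<open>part l (r + 1)\<close>, which is 0 since
  \<open>length l \<le> r\<close>.\<close>

lemma level_counts_partial_sum:
  assumes "s \<le> r"
  shows "(\<Sum>t<s. e t - 1) = part l (r - s + 1)"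
  using assms
proof (induction s)
  case 0
  then show ?case using length_le_r by (simp add: part_beyond)
next
  case (Suc s)
  have "r - Suc s + 1 = r - s" using Suc.prems by simp
  moreover have "(\<Sum>t<Suc s. e t - 1) = part l (r - s + 1) + (e s - 1)"
    using Suc by simp
  ultimately show ?case
    using level_counts_add[of s] level_counts_pos_iff[of s] Suc.prems by simp
qed

lemma level_counts_sum:
  assumes "r \<le> K"
  shows "(\<Sum>t<K. e t) = N"
proof -
  have "(\<Sum>t<K. e t) = (\<Sum>t<r. e t)"
    using assms by (intro sum.mono_neutral_right) (auto simp: level_counts_beyond)
  also have "\<dots> = (\<Sum>t<r. (e t - 1) + 1)"
    by (intro sum.cong) (auto simp: level_counts_pos_iff)
  also have "\<dots> = part l 1 + r"
    using level_counts_partial_sum[of r] by (simp add: sum_Suc)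
  finally show ?thesis using r_plus by simp
qed

text \<open>Summation by parts: the partial sums of \<open>e t - 1\<close> are the parts of
  \<open>l\<close> from last to first, so they add up to \<open>sum_list l\<close>, and the boundary
  term is \<open>r * part l 1\<close>. Expanding \<open>N choose 2\<close> at
  \<open>N = r + part l 1\<close> absorbs the rest.\<close>

lemma level_counts_weighted_sum:
  assumes "r \<le> K"
  shows "(\<Sum>t<K. t * e t) + ((part l 1 choose 2) + sum_list l) = N choose 2"
proof -
  define P where "P s = (\<Sum>t<s. e t - 1)" for s
  have "(\<Sum>t<K. t * e t) = (\<Sum>t<r. t * e t)"
    using assms by (intro sum.mono_neutral_right) (auto simp: level_counts_beyond)
  moreover have by_parts: "(\<Sum>t<s. t * e t) + (\<Sum>i<s. P (Suc i)) = (s choose 2) + s * P s" if "s \<le> r" for s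
    using that
  proof (induction s)
    case (Suc s)
    have "e s > 0" using level_counts_pos_iff[of s] Suc.prems by simp
    then obtain d where d: "e s = Suc d" by (cases "e s") auto
    have "P (Suc s) = P s + d"
      by (simp add: P_def d)
    moreover have "Suc s choose 2 = (s choose 2) + s"
      by (simp add: numeral_2_eq_2)
    moreover have "(\<Sum>t<s. t * e t) + (\<Sum>i<s. P (Suc i)) = (s choose 2) + s * P s"
      using Suc by simp
    ultimately show ?case
      by (simp add: d algebra_simps)
  qed (simp add: P_def)
  moreover have "(\<Sum>i<r. P (Suc i)) = sum_list l"
  proof -
    have "(\<Sum>i<r. P (Suc i)) = (\<Sum>i<r. part l (r - i))"
    proof (intro sum.cong refl)
      show "P (Suc i) = part l (r - i)" if "i \<in> {..<r}" for i
        using level_counts_partial_sum[of "Suc i"] that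
        by (simp add: P_def Suc_diff_Suc del: sum.lessThan_Suc)
    qed
    also have "\<dots> = (\<Sum>i=1..r. part l i)"
      by (rule sum.reindex_bij_witness[of _ "\<lambda>i. r - i" "\<lambda>i. r - i"]) auto
    finally show ?thesis using sum_list_part[OF length_le_r] by simp
  qed
  moreover have "P r = part l 1"
    using level_counts_partial_sum[of r] by (simp add: P_def)
  moreover have "N choose 2 = (r choose 2) + (part l 1 choose 2) + r * part l 1"
    using choose_two_add[of r "part l 1"] r_plus by simp
  ultimately show ?thesis using by_parts[of r] by simp
qed

lemma alternating_sum_by_parts:
  fixes P :: "nat \<Rightarrow> int"
  shows "(\<Sum>t<s. (- 1) ^ t * (P (Suc t) - P t)) + (- 1) ^ s * P s + 2 * (\<Sum>t<s. (- 1) ^ t * P t) = P 0"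
  by (induction s) (auto simp: algebra_simps)

lemma alternating_sum_nats: "2 * (\<Sum>i=1..m. (- 1) ^ (i - 1) * int i) = (if even m then - int m else int m + 1)"
  by (induction m) auto

text \<open>Twice the sum over even levels is the total \<open>2 * M\<close> plus the alternating
  sum of all \<open>e t\<close>. As \<open>e t\<close> is 1 plus a difference of consecutive parts,
  summation by parts turns the latter into an alternating sum of parts. Doubling avoids
  halves.\<close>

lemma level_counts_even_sum:
  assumes "r \<le> K" "N = 2 * M" "M > 0"
  shows "int (\<Sum>t | t < K \<and> even t. e t) = int M + alt_sum l"
proof -
  let ?m = "part l 1"
  define P where "P s = int (if s = 0 then 0 else part l (r - s + 1))" for s
  have e: "int (e t) = 1 + (P (Suc t) - P t)" if "t < r" for t
    using level_counts_add[OF that] that length_le_r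
    by (cases "t = 0") (auto simp: P_def part_beyond Suc_diff_Suc)
  have sgn: "(- 1) ^ i = (if even i then 1 else - 1 :: int)" for i
    by simp
  have S0: "2 * int (\<Sum>t | t < K \<and> even t. e t)
      = (\<Sum>t<K. int (e t)) + (\<Sum>t<K. (- 1) ^ t * int (e t))"
  proof -
    have "(\<Sum>t<K. int (e t)) + (\<Sum>t<K. (- 1) ^ t * int (e t))
        = (\<Sum>t<K. if even t then 2 * int (e t) else 0)"
      unfolding sum.distrib[symmetric] by (intro sum.cong) auto
    also have "\<dots> = (\<Sum>t\<in>{..<K} \<inter> {t. even t}. 2 * int (e t))"
      by (simp add: sum.If_cases)
    also have "{..<K} \<inter> {t. even t} = {t. t < K \<and> even t}" by auto
    finally show ?thesis by (simp add: sum_distrib_left)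
  qed
  have S1: "(\<Sum>t<K. int (e t)) = 2 * int M"
    using level_counts_sum[OF assms(1)] assms(2) by (simp flip: of_nat_sum)
  have S2: "(\<Sum>t<K. (- 1) ^ t * int (e t)) = (\<Sum>t<r. (- 1) ^ t * int (e t))"
    using assms by (intro sum.mono_neutral_right) (auto simp: level_counts_beyond)
  have S3: "(\<Sum>t<r. (- 1) ^ t * int (e t))
      = (\<Sum>t<r. (- 1) ^ t) + (\<Sum>t<r. (- 1) ^ t * (P (Suc t) - P t))"
    by (simp add: e distrib_left sum.distrib)
  have S4: "(\<Sum>t<r. (- 1) ^ t) = (if even r then 0 else 1 :: int)" for r
    by (induction r) auto
  have S5: "P r = ?m"
    using assms r_plus part_beyond[of l 1] length_le_r by (cases "r = 0") (auto simp: P_def)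
  have S6: "(\<Sum>t<r. (- 1) ^ t * P t) = - (\<Sum>i=2..length l. (- 1) ^ (?m + i - 2) * int (part l i))"
  proof -
    have par: "even r \<longleftrightarrow> even ?m" using r_plus assms(2) by presburger
    have "(\<Sum>t<r. (- 1) ^ t * P t) = (\<Sum>t\<in>{1..<r}. (- 1) ^ t * P t)"
      by (rule sum.mono_neutral_right) (auto simp: P_def)
    also have "\<dots> = (\<Sum>i=2..r. - ((- 1) ^ (?m + i - 2) * int (part l i)))"
    \<comment> \<open>The substitution \<open>i = r + 1 - t\<close> flips the sign, since
      \<open>r\<close> and \<open>part l 1\<close> have the even sum \<open>2 * M\<close> and hence
      equal parity.\<close>
    proof (rule sum.reindex_bij_witness[of _ "\<lambda>i. r + 1 - i" "\<lambda>t. r + 1 - t"])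
      fix t assume t: "t \<in> {1..<r}"
      have "even (?m + (r + 1 - t) - 2) \<longleftrightarrow> odd t"
        using t par by (auto simp: even_diff_nat)
      then show "- ((- 1) ^ (?m + (r + 1 - t) - 2) * int (part l (r + 1 - t))) = (- 1) ^ t * P t"
        using t unfolding sgn by (auto simp: P_def Suc_diff_le)
    qed auto
    also have "\<dots> = (\<Sum>i=2..length l. - ((- 1) ^ (?m + i - 2) * int (part l i)))"
      using length_le_r by (intro sum.mono_neutral_right) (auto simp: part_beyond)
    finally show ?thesis by (simp add: sum_negf)
  qed
  have S7: "(\<Sum>t<r. (- 1) ^ t * (P (Suc t) - P t)) + (- 1) ^ r * P r + 2 * (\<Sum>t<r. (- 1) ^ t * P t) = 0"
    using alternating_sum_by_parts[of P r] by (simp add: P_def)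
  have par: "even r \<longleftrightarrow> even ?m" using r_plus assms(2) by presburger
  show ?thesis
    using S0 S7 alternating_sum_nats[of ?m] unfolding alt_sum_def S1 S2 S3 S4 S5 S6 sgn[of r] par
    by (cases "even ?m") (simp_all only: if_True if_False)
qed

text \<open>Level \<open>i\<close> corresponds to index \<open>r - i\<close>. For the consecutive
  parts \<open>a\<close>, \<open>b\<close>, \<open>c\<close> there,
  \<open>e i + e (i - 1) - 1 = a - c + 1\<close>, and choosing \<open>e i = 1 + a - b\<close> of
  these is the same as choosing the complementary \<open>b - c\<close>.\<close>

lemma binom_prod_level_counts:
  assumes "N \<le> K"
  shows "binom_prod l = (\<Prod>i=1..K. level_factor 0 e i)"
proof -
  have "(\<Prod>i=1..K. level_factor 0 e i) = (\<Prod>i\<in>{1..<r}. level_factor 0 e i)"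
  proof (rule prod.mono_neutral_right)
    show "\<forall>i\<in>{1..K} - {1..<r}. level_factor 0 e i = 1"
      by (auto simp: level_factor_def level_counts_beyond)
  qed (use assms r_plus in auto)
  also have "\<dots> = (\<Prod>i\<in>{1..<r}. binom_factor l i)"
  proof (rule prod.reindex_bij_witness[of _ "\<lambda>i. r - i" "\<lambda>i. r - i"])
    fix i assume i: "i \<in> {1..<r}"
    define a b c where "a = part l (r - i)" and "b = part l (r - i + 1)" and "c = part l (r - i + 2)"
    have "a \<ge> b" "b \<ge> c"
      using i unfolding a_def b_def c_def by (auto intro!: part_antimono[OF is_partition_l])
    moreover have "e i = 1 + a - b" "e (i - 1) = 1 + b - c"
      using level_counts_add[of i] level_counts_add[of "i - 1"] less_imp_diff_less[of i r 1] i
      by (auto simp: a_def b_def c_def Suc_diff_Suc Suc_diff_le numeral_2_eq_2) linarith+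
    ultimately have "level_factor 0 e i = (a - c + 1) choose (1 + a - b)"
      using i by (simp add: level_factor_def Suc_diff_le)
    also have "\<dots> = (a - c + 1) choose (b - c)"
      using binomial_symmetric[of "b - c" "a - c + 1"] \<open>a \<ge> b\<close> \<open>b \<ge> c\<close> by (simp add: Suc_diff_le)
    finally show "binom_factor l (r - i) = level_factor 0 e i"
      by (simp add: binom_factor_def a_def b_def c_def)
  qed auto
  also have "\<dots> = (\<Prod>i\<in>{1..r}. binom_factor l i)"
  proof (rule prod.mono_neutral_left)
    show "\<forall>i\<in>{1..r} - {1..<r}. binom_factor l i = 1"
      using length_le_r by (auto simp: binom_factor_def part_beyond)
  qed auto
  also have "\<dots> = binom_prod l"
    unfolding binom_prod_def using length_le_r
    by (intro prod.mono_neutral_right) (auto simp: binom_factor_eq_1)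
  finally show ?thesis by simp
qed

end

text \<open>The support gives the first part, and the partial sums of \<open>e t - 1\<close> give
  all parts.\<close>

lemma level_counts_inj: "inj_on (level_counts N) (partitions_upto N)"
proof (rule inj_onI)
  fix k l assume k: "k \<in> partitions_upto N" and l: "l \<in> partitions_upto N"
    and eq: "level_counts N k = level_counts N l"
  let ?r = "N - part k 1"
  have "t < N - part k 1 \<longleftrightarrow> t < N - part l 1" for t
    using level_counts_pos_iff[OF k, of t] level_counts_pos_iff[OF l, of t] eq by simp
  from this[of "N - part k 1"] this[of "N - part l 1"] have r: "N - part k 1 = N - part l 1"
    by simp
  show "k = l"
  proof (rule partition_eqI)
    fix i :: nat assume "i \<ge> 1"
    show "part k i = part l i"
    proof (cases "i \<le> ?r")
      case True
      define s where "s = ?r + 1 - i"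
      have s: "?r - s + 1 = i" "s \<le> ?r"
        using True \<open>i \<ge> 1\<close> by (auto simp: s_def)
      have "part k (?r - s + 1) = part l (?r - s + 1)"
        using level_counts_partial_sum[OF k, of s] level_counts_partial_sum[OF l, of s] s(2)
        unfolding eq r[symmetric] by metis
      then show ?thesis by (simp only: s(1))
    next
      case False
      then show ?thesis
        using length_le_r[OF k] length_le_r[OF l] r by (simp add: part_beyond)
    qed
  qed (use k l in \<open>auto simp: partitions_upto_def\<close>)
qed

text \<open>The partial sums of \<open>e t - 1\<close> are increasing and serve as the parts in
  reverse order; the total \<open>N\<close> forces the first part to be
  \<open>N - r\<close>.\<close>

lemma level_counts_surj:
  assumes pos: "\<And>t. e t > 0 \<longleftrightarrow> t < r" and sum: "(\<Sum>t<r. e t) = N"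
  obtains l where "l \<in> partitions_upto N" "level_counts N l = e"
proof -
  define p where "p i = (\<Sum>t<r + 1 - i. e t - 1)" for i
  have "p (Suc i) \<le> p i" for i
    unfolding p_def by (intro sum_mono2) auto
  moreover have "p (Suc r) = 0" by (simp add: p_def)
  ultimately obtain l where l: "is_partition l" "length l \<le> r" "\<And>i. i \<ge> 1 \<Longrightarrow> part l i = p i"
    using partition_exists[of p r] by metis
  have "N = (\<Sum>t<r. (e t - 1) + 1)"
    unfolding sum[symmetric] by (intro sum.cong) (auto simp: pos)
  also have "\<dots> = part l 1 + r"
    by (simp add: l(3) p_def sum_Suc)
  finally have N: "N = part l 1 + r" .
  show ?thesis
  proof
    show "l \<in> partitions_upto N"
      using l N by (simp add: partitions_upto_def)
    show "level_counts N l = e"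
    proof
      fix t
      show "level_counts N l t = e t"
      proof (cases "t < r")
        case True
        then have "part l (r - t) = p (r - t)" "part l (r - t + 1) = p (r - t + 1)"
          by (auto intro!: l(3))
        moreover have "p (r - t) = p (r - t + 1) + (e t - 1)"
          using True by (simp add: p_def Suc_diff_le)
        ultimately show ?thesis
          using True pos[of t] by (simp add: level_counts_def N)
      qed (use pos[of t] in \<open>auto simp: level_counts_def N\<close>)
    qed
  qed
qed

section \<open>Comparing the two counts\<close>

text \<open>The levels that a Dyck path leaves by down steps form an initial segment, so its level
  counts come from a partition.\<close>

lemma UN_words_level_counts:
  "(\<Union>l\<in>partitions_upto N. words 0 (level_counts N l)) = {w. dyck_from 0 w \<and> length w = 2 * N}"
proof (intro equalityI subsetI)
  fix w assume "w \<in> (\<Union>l\<in>partitions_upto N. words 0 (level_counts N l))"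
  then obtain l where l: "l \<in> partitions_upto N" and w: "dyck_from 0 w" "down_steps 0 w = level_counts N l"
    by (auto simp: words_def)
  have "length w = 2 * (\<Sum>i<N + length w. level_counts N l i)"
    using length_dyck(1)[OF w(1), of "N + length w"] w(2) by simp
  also have "(\<Sum>i<N + length w. level_counts N l i) = N"
    by (rule level_counts_sum[OF l]) simp
  finally show "w \<in> {w. dyck_from 0 w \<and> length w = 2 * N}"
    using w by simp
next
  fix w assume "w \<in> {w. dyck_from 0 w \<and> length w = 2 * N}"
  then have w: "dyck_from 0 w" "length w = 2 * N" by auto
  define e where "e = down_steps 0 w"
  define r where "r = (LEAST t. e t = 0)"
  have e0: "e (2 * N) = 0"
    using w by (simp add: e_def down_steps_eq_0)
  have r: "e r = 0" "r \<le> 2 * N"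
    unfolding r_def using e0 by (auto intro: LeastI Least_le)
  have zero: "e t = 0" if "t \<ge> r" for t
    using that
  proof (induction t rule: dec_induct)
    case (step t)
    then show ?case
      using down_steps_connected[OF w(1), of t] by (auto simp: e_def)
  qed (rule r)
  have pos: "e t > 0 \<longleftrightarrow> t < r" for t
    using zero[of t] not_less_Least[of t "\<lambda>t. e t = 0"] unfolding r_def[symmetric]
    by (cases "t < r") auto
  have "(\<Sum>t<r. e t) = (\<Sum>t<2 * N. e t)"
    using r(2) zero by (intro sum.mono_neutral_left) auto
  also have "\<dots> = N"
    using length_dyck(1)[OF w(1), of "2 * N"] w(2) by (simp add: e_def)
  finally obtain l where "l \<in> partitions_upto N" "level_counts N l = e"
    using level_counts_surj[of e r N] pos by metis
  then show "w \<in> (\<Union>l\<in>partitions_upto N. words 0 (level_counts N l))"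
    using w by (auto simp: words_def e_def intro!: bexI[of _ l])
qed

lemma two_times_choose_two: "2 * (n choose 2) = n * (n - 1)"
  by (induction n) (auto simp: numeral_2_eq_2 algebra_simps split: nat.split)

lemma square_eq_choose_two: "n * n = 2 * (n choose 2) + n"
  using two_times_choose_two[of n] by (cases n) auto

abbreviation (input) weight :: "nat list \<Rightarrow> nat" where
  "weight l \<equiv> (part l 1 choose 2) + sum_list l"

text \<open>The second claim follows by eliminating the weighted level sum between the identity for
  paths and the one for partitions. As \<open>2 * M choose 2\<close> is the least sum of
  \<open>2 * M\<close> positions, the weight is the excess over that minimum.\<close>

lemma words_level_counts_stats:
  assumes l: "l \<in> partitions_upto (2 * M)" and w: "w \<in> words 0 (level_counts (2 * M) l)" and "M > 0"
  shows "int (card {i\<in>positions w. even i}) = int M + alt_sum l"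
    and "\<Sum>(positions w) = (2 * M choose 2) + weight l"
proof -
  let ?N = "2 * M"
  let ?K = "?N + length w"
  have w: "dyck_from 0 w" "down_steps 0 w = level_counts ?N l"
    using w by (auto simp: words_def)
  have K: "0 + length w \<le> ?K" "?N - part l 1 \<le> ?K" by auto
  show "int (card {i\<in>positions w. even i}) = int M + alt_sum l"
    using length_dyck(3)[OF w(1) K(1)] level_counts_even_sum[OF l K(2) refl \<open>M > 0\<close>] w(2)
    by simp
  have c: "card (positions w) = ?N"
    using length_dyck(2)[OF w(1) K(1)] level_counts_sum[OF l K(2)] w(2) by simp
  have "\<Sum>(positions w) + (\<Sum>i<?K. i * level_counts ?N l i) + ?N = ?N * ?N"
    using length_dyck(4)[OF w(1) K(1)] w(2) by (simp add: c power2_eq_square)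
  moreover note square_eq_choose_two[of ?N]
  moreover note level_counts_weighted_sum[OF l K(2)]
  ultimately show "\<Sum>(positions w) = (?N choose 2) + weight l"
    by linarith
qed

lemma finite_partitions_upto: "finite (partitions_upto N)"
proof (rule finite_subset)
  show "partitions_upto N \<subseteq> {l. set l \<subseteq> {..N} \<and> length l \<le> N}"
  proof safe
    fix l x assume l: "l \<in> partitions_upto N" and "x \<in> set l"
    then obtain i where "i < length l" "x = part l (Suc i)"
      by (auto simp: in_set_conv_nth part_def)
    then show "x \<le> N"
      using part_antimono[of l 1 "Suc i"] l by (auto simp: partitions_upto_def)
  qed (auto simp: partitions_upto_def)
qed (rule finite_lists_length_le, simp)

text \<open>Dyck words are grouped by their level counts. The group of \<open>l\<close> has
  \<open>binom_prod l\<close> members, both statistics are constant on it, and injectivity of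
  \<open>level_counts\<close> makes the groups disjoint.\<close>

lemma sum_binom_prod_eq_card_words:
  assumes "M > 0"
  shows "(\<Sum>l | l \<in> partitions_upto (2 * M) \<and> alt_sum l = j \<and> weight l = n. binom_prod l)
    = card {w. dyck_from 0 w \<and> length w = 2 * (2 * M) \<and>
        int (card {i\<in>positions w. even i}) = int M + j \<and> \<Sum>(positions w) = (2 * M choose 2) + n}"
    (is "sum _ ?L = card ?W")
proof -
  let ?N = "2 * M"
  have W: "?W = (\<Union>l\<in>?L. words 0 (level_counts ?N l))"
  proof (intro equalityI subsetI)
    fix w assume w: "w \<in> ?W"
    then have "w \<in> (\<Union>l\<in>partitions_upto ?N. words 0 (level_counts ?N l))"
      unfolding UN_words_level_counts by simp
    then obtain l where l: "l \<in> partitions_upto ?N" "w \<in> words 0 (level_counts ?N l)"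
      by blast
    with w have "l \<in> ?L"
      using words_level_counts_stats[OF l assms] by simp
    with l show "w \<in> (\<Union>l\<in>?L. words 0 (level_counts ?N l))" by blast
  next
    fix w assume "w \<in> (\<Union>l\<in>?L. words 0 (level_counts ?N l))"
    then obtain l where l: "l \<in> ?L" "w \<in> words 0 (level_counts ?N l)" by blast
    then have "w \<in> {w. dyck_from 0 w \<and> length w = 2 * ?N}"
      unfolding UN_words_level_counts[symmetric] by blast
    then show "w \<in> ?W"
      using words_level_counts_stats[OF _ l(2) assms] l(1) by simp
  qed
  have words: "finite (words 0 (level_counts ?N l))"
      "card (words 0 (level_counts ?N l)) = binom_prod l" if "l \<in> ?L" for l
  proof -
    have l: "l \<in> partitions_upto ?N" using that by simp
    have "level_counts ?N l i = 0" if "i \<ge> ?N" for i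
      by (rule level_counts_beyond[OF l]) (use that in simp)
    from card_words[of ?N "level_counts ?N l" 0, OF this]
    show "finite (words 0 (level_counts ?N l))"
      "card (words 0 (level_counts ?N l)) = binom_prod l"
      using binom_prod_level_counts[OF l, of ?N] by auto
  qed
  have "card ?W = (\<Sum>l\<in>?L. card (words 0 (level_counts ?N l)))"
    unfolding W
  proof (rule card_UN_disjoint)
    show "finite ?L" using finite_partitions_upto by simp
    show "\<forall>l\<in>?L. finite (words 0 (level_counts ?N l))" using words by blast
    show "\<forall>k\<in>?L. \<forall>l\<in>?L. k \<noteq> l \<longrightarrow>
        words 0 (level_counts ?N k) \<inter> words 0 (level_counts ?N l) = {}"
    proof safe
      fix k l w assume "k \<in> partitions_upto ?N" "l \<in> partitions_upto ?N" "k \<noteq> l"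
        and "w \<in> words 0 (level_counts ?N k)" "w \<in> words 0 (level_counts ?N l)"
      then show "w \<in> {}"
        using inj_onD[OF level_counts_inj[of ?N], of k l] by (simp add: words_def)
    qed
  qed
  then show ?thesis using words by simp
qed

section \<open>From sets of positions with small sum back to Dyck words\<close>

lemma nat_set_bounded:
  assumes "finite A" "\<Sum>A = (card A choose 2) + n" "x \<in> A"
  shows "x < card A + n"
proof -
  have c: "card (A - {x}) = card A - 1" "card A > 0"
    using assms by (auto simp: card_gt_0_iff)
  \<comment> \<open>The other elements already sum to at least \<open>(card A - 1) choose 2\<close>,
    which leaves at most \<open>card A - 1 + n\<close> for \<open>x\<close>.\<close>
  have "(card A - 1) * (card A - 1 - 1) \<le> 2 * \<Sum>(A - {x})"
    using sum_nat_set_ge[of "A - {x}"] assms c by simp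
  moreover have "\<Sum>A = x + \<Sum>(A - {x})"
    using assms by (simp add: sum.remove)
  moreover have "2 * (card A choose 2) = (card A - 1) * (card A - 1 - 1) + 2 * (card A - 1)"
    unfolding two_times_choose_two by (cases "card A"; cases "card A - 1") auto
  ultimately show ?thesis
    using assms(2) c(2) by linarith
qed

lemma inj_on_positions: "inj_on positions {w. length w = k}"
proof (rule inj_onI)
  fix v w :: "bool list" assume "v \<in> {w. length w = k}" "w \<in> {w. length w = k}"
    and eq: "positions v = positions w"
  then have len: "length v = k" "length w = k" by auto
  have "v ! i = w ! i" if "i < k" for i
    using eq len that unfolding positions_def set_eq_iff by auto
  with len show "v = w" by (intro nth_equalityI) auto
qed

text \<open>An excess \<open>n\<close> below \<open>N\<close> keeps all elements below
  \<open>2 * N\<close> and is too small for a path that leaves the region, so every such set comes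
  from a Dyck word. The predicate \<open>P\<close> will fix the number of even positions.\<close>

lemma bij_betw_positions:
  assumes "n < N"
  shows "bij_betw positions
    {w. dyck_from 0 w \<and> length w = 2 * N \<and> P (positions w) \<and> \<Sum>(positions w) = (N choose 2) + n}
    {A. finite A \<and> card A = N \<and> P A \<and> \<Sum>A = (N choose 2) + n}"
  unfolding bij_betw_def
proof (intro conjI equalityI subsetI)
  show "inj_on positions
    {w. dyck_from 0 w \<and> length w = 2 * N \<and> P (positions w) \<and> \<Sum>(positions w) = (N choose 2) + n}"
    by (rule inj_on_subset[OF inj_on_positions[of "2 * N"]]) auto
next
  fix A assume "A \<in> positions `
    {w. dyck_from 0 w \<and> length w = 2 * N \<and> P (positions w) \<and> \<Sum>(positions w) = (N choose 2) + n}"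
  then obtain w where w: "A = positions w" "dyck_from 0 w" "length w = 2 * N" "P A"
      "\<Sum>A = (N choose 2) + n"
    by blast
  have "card A = N"
    using length_dyck(1,2)[OF w(2), of "2 * N"] w(1,3) by simp
  with w show "A \<in> {A. finite A \<and> card A = N \<and> P A \<and> \<Sum>A = (N choose 2) + n}" by simp
next
  fix A assume "A \<in> {A. finite A \<and> card A = N \<and> P A \<and> \<Sum>A = (N choose 2) + n}"
  then have A: "finite A" "card A = N" "P A" "\<Sum>A = (N choose 2) + n" by auto
  define w where "w = map (\<lambda>i. i \<in> A) [0..<2 * N]"
  have "x < 2 * N" if "x \<in> A" for x
    using nat_set_bounded[of A n x] A that assms by simp
  then have w: "positions w = A"
    by (auto simp: positions_def w_def)
  have "dyck_from 0 w"
  proof (rule ccontr)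
    assume "\<not> dyck_from 0 w"
    then have "N * (N - 1) + 2 * N \<le> 2 * \<Sum>A"
      using dyck_or_large[of w 0] w A by (simp add: w_def)
    then show False
      using A(4) two_times_choose_two[of N] assms by linarith
  qed
  with w A show "A \<in> positions `
    {w. dyck_from 0 w \<and> length w = 2 * N \<and> P (positions w) \<and> \<Sum>(positions w) = (N choose 2) + n}"
    by (intro image_eqI[of _ _ w]) (auto simp: w_def)
qed

text \<open>The halves of the even and of the odd elements are two independent sets of sizes
  \<open>a\<close> and \<open>b\<close>. Each odd element has one unit beyond twice its half, whence
  \<open>fps_X ^ b\<close>.\<close>

lemma enum_fps_even_odd:
  "enum_fps (\<lambda>A. \<Sum>A) {A. finite A \<and> card A = a + b \<and> card {i\<in>A. even i} = a}
    = fps_X ^ b * (subsets_fps a * subsets_fps b)"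
proof -
  let ?P = "\<lambda>k. {A :: nat set. finite A \<and> card A = k}"
  let ?f = "\<lambda>(A, B). (\<lambda>i. 2 * i) ` A \<union> (\<lambda>i. Suc (2 * i)) ` B :: nat set"
  let ?g = "\<lambda>A. ({i. 2 * i \<in> A}, {i. Suc (2 * i) \<in> A}) :: nat set \<times> nat set"
  let ?S = "{A :: nat set. finite A \<and> card A = a + b \<and> card {i\<in>A. even i} = a}"
  have inj: "inj_on (\<lambda>i :: nat. 2 * i) A" "inj_on (\<lambda>i :: nat. Suc (2 * i)) A" for A
    by (auto simp: inj_on_def)
  have disj: "(\<lambda>i :: nat. 2 * i) ` A \<inter> (\<lambda>i :: nat. Suc (2 * i)) ` B = {}" for A B
    by (auto, presburger)
  have evens: "(\<lambda>i. 2 * i) ` {i. 2 * i \<in> A} = {i\<in>A. even i}" for A :: "nat set"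
    by (auto elim!: evenE)
  have odds: "(\<lambda>i. Suc (2 * i)) ` {i. Suc (2 * i) \<in> A} = {i\<in>A. odd i}" for A :: "nat set"
    by (auto elim!: oddE)
  have fin: "finite {i. 2 * i \<in> A}" "finite {i. Suc (2 * i) \<in> A}" if "finite A" for A :: "nat set"
    using finite_imageD[OF _ inj(1), of "{i. 2 * i \<in> A}"]
      finite_imageD[OF _ inj(2), of "{i. Suc (2 * i) \<in> A}"] that
    unfolding evens odds by auto
  have "bij_betw ?f (?P a \<times> ?P b) ?S"
  proof (rule bij_betw_byWitness[where f' = ?g])
    show "\<forall>x\<in>?P a \<times> ?P b. ?g (?f x) = x"
      by (auto, presburger+)
    show "\<forall>A\<in>?S. ?f (?g A) = A"
      unfolding prod.case evens odds by auto
    show "?f ` (?P a \<times> ?P b) \<subseteq> ?S"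
    proof (rule image_subsetI)
      fix x assume "x \<in> ?P a \<times> ?P b"
      then obtain A B where x: "x = (A, B)" and AB: "finite A" "finite B" "card A = a" "card B = b"
        by blast
      let ?C = "(\<lambda>i. 2 * i) ` A \<union> (\<lambda>i. Suc (2 * i)) ` B"
      have "card ?C = a + b"
        using AB disj by (simp add: card_Un_disjoint card_image inj)
      moreover have "{i\<in>?C. even i} = (\<lambda>i. 2 * i) ` A" by auto
      then have "card {i\<in>?C. even i} = a"
        by (simp only: card_image[OF inj(1)] AB)
      ultimately show "?f x \<in> ?S"
        using AB by (simp add: x)
    qed
    show "?g ` ?S \<subseteq> ?P a \<times> ?P b"
    proof (rule image_subsetI)
      fix A assume "A \<in> ?S"
      then have A: "finite A" "card A = a + b" "card {i\<in>A. even i} = a" by auto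
      have "card {i. 2 * i \<in> A} = card {i\<in>A. even i}"
        unfolding evens[symmetric] by (simp only: card_image[OF inj(1)])
      moreover have "card {i. Suc (2 * i) \<in> A} = card {i\<in>A. odd i}"
        unfolding odds[symmetric] by (simp only: card_image[OF inj(2)])
      moreover have "card ({i\<in>A. even i} \<union> {i\<in>A. odd i}) = card {i\<in>A. even i} + card {i\<in>A. odd i}"
        using A(1) by (intro card_Un_disjoint) auto
      moreover have "{i\<in>A. even i} \<union> {i\<in>A. odd i} = A" by auto
      ultimately show "?g A \<in> ?P a \<times> ?P b"
        using A fin[OF A(1)] by simp
    qed
  qed
  then have "enum_fps (\<lambda>A. \<Sum>A) ?S
      = fps_X ^ b * enum_fps (\<lambda>(A, B). 2 * \<Sum>A + 2 * \<Sum>B) (?P a \<times> ?P b)"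
  proof (rule enum_fps_bij_betw)
    fix x assume "x \<in> ?P a \<times> ?P b"
    then obtain A B where x: "x = (A, B)" "finite A" "finite B" "card B = b" by auto
    have "\<Sum>((\<lambda>i. 2 * i) ` A \<union> (\<lambda>i. Suc (2 * i)) ` B)
        = \<Sum>((\<lambda>i. 2 * i) ` A) + \<Sum>((\<lambda>i. Suc (2 * i)) ` B)"
      using x disj by (intro sum.union_disjoint) auto
    also have "\<dots> = 2 * \<Sum>A + 2 * \<Sum>B + b"
      using x by (simp add: sum.reindex inj sum_Suc sum_distrib_left)
    finally show "\<Sum>(?f x) = (case x of (A, B) \<Rightarrow> 2 * \<Sum>A + 2 * \<Sum>B) + b"
      by (simp add: x)
  qed
  also have "enum_fps (\<lambda>(A, B). 2 * \<Sum>A + 2 * \<Sum>B) (?P a \<times> ?P b) = subsets_fps a * subsets_fps b"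
    unfolding subsets_fps_def
    by (rule enum_fps_Times; rule finite_subset[OF _ finite_sets_sum_eq]) auto
  finally show ?thesis .
qed

text \<open>The words have \<open>a = M + j\<close> even and \<open>b = M - j\<close> odd down-step
  positions. Both numbers are at least \<open>n\<close>, so up to degree \<open>n\<close> the finite
  products may be replaced by the infinite one.\<close>

lemma sum_binom_prod_eq_fps_nth:
  fixes j :: int
  assumes "M > n + nat \<bar>j\<bar>"
  shows "of_nat (\<Sum>l | l \<in> partitions_upto (2 * M) \<and> alt_sum l = j \<and> weight l = n. binom_prod l)
    = fps_nth (fps_X ^ nat (j * (2 * j - 1)) * inverse (euler_inf_fps ^ 2)) n"
proof -
  define a b where "a = nat (int M + j)" and "b = nat (int M - j)"
  define c where "c = (2 * M choose 2)"
  define J where "J = nat (j * (2 * j - 1))"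
  define E where "E = euler_fps a * euler_fps b"
  have ab: "int a = int M + j" "int b = int M - j" "a + b = 2 * M" "n \<le> a" "n \<le> b"
    using assms by (auto simp: a_def b_def)
  \<comment> \<open>Nonnegativity for every integer \<open>j\<close> ensures that \<open>nat\<close>
    does not alter the exponent.\<close>
  have "j * (2 * j - 1) \<ge> 0"
    by (cases "j \<ge> 1") (auto intro: mult_nonpos_nonpos)
  then have J: "int J = j * (2 * j - 1)" by (simp add: J_def)
  have E0: "fps_nth E 0 = 1" by (simp add: E_def)
  \<comment> \<open>The least position sum for the given parities: both sides equal
    \<open>2 * M^2 - M + 2 * j^2 - j\<close>.\<close>
  have exps: "b + (a * (a - 1) + b * (b - 1)) = c + J"
  proof -
    have sq: "int (k * (k - 1)) = int k * int k - int k" for k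
      by (cases k) (auto simp: algebra_simps)
    have "int (2 * M) * int (2 * M) = 2 * int c + int (2 * M)"
      unfolding c_def using square_eq_choose_two[of "2 * M"]
      by (metis of_nat_add of_nat_mult of_nat_numeral)
    then have "2 * int (b + (a * (a - 1) + b * (b - 1))) = 2 * int (c + J)"
      unfolding of_nat_add J sq ab(1,2) by (simp add: algebra_simps)
    then show ?thesis
      by (metis mult_cancel_left of_nat_eq_iff zero_neq_numeral)
  qed
  let ?Y = "fps_X ^ b * (subsets_fps a * subsets_fps b)"
  have "?Y * E = fps_X ^ b * ((subsets_fps a * euler_fps a) * (subsets_fps b * euler_fps b))"
    by (simp add: E_def mult_ac)
  also have "\<dots> = fps_X ^ (c + J)"
    unfolding subsets_fps_mult_euler power_add[symmetric] exps ..
  finally have "?Y * E * inverse E = fps_X ^ (c + J) * inverse E" by simp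
  then have Y: "?Y = fps_X ^ c * (fps_X ^ J * inverse E)"
    using E0 by (simp add: mult.assoc inverse_mult_eq_1' power_add)
  have "(\<Sum>l | l \<in> partitions_upto (2 * M) \<and> alt_sum l = j \<and> weight l = n. binom_prod l)
      = card {A. finite A \<and> card A = 2 * M \<and> int (card {i\<in>A. even i}) = int M + j \<and> \<Sum>A = c + n}"
    unfolding c_def using assms
    by (subst sum_binom_prod_eq_card_words, simp)
      (intro bij_betw_same_card[of positions] bij_betw_positions, simp)
  also have "{A. finite A \<and> card A = 2 * M \<and> int (card {i\<in>A. even i}) = int M + j \<and> \<Sum>A = c + n}
      = {A \<in> {A. finite A \<and> card A = a + b \<and> card {i\<in>A. even i} = a}. \<Sum>A = c + n}"
    using ab by auto
  finally have "of_nat (\<Sum>l | l \<in> partitions_upto (2 * M) \<and> alt_sum l = j \<and> weight l = n. binom_prod l)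
      = fps_nth ?Y (c + n)"
    unfolding enum_fps_even_odd[symmetric] by simp
  also have "\<dots> = fps_nth (fps_X ^ J * inverse E) n"
    unfolding Y by (simp add: fps_X_power_mult_nth)
  also have "fps_agree n (fps_X ^ J * inverse E) (fps_X ^ J * inverse (euler_inf_fps * euler_inf_fps))"
  proof (intro fps_agree_mult fps_agree_inverse)
    have "fps_agree n (euler_inf_fps * euler_inf_fps) E"
      unfolding E_def using ab by (intro fps_agree_mult euler_inf_fps_agree)
    then show "fps_agree n E (euler_inf_fps * euler_inf_fps)"
      by (simp add: fps_agree_def)
  qed (auto simp: E0 fps_agree_def)
  then have "fps_nth (fps_X ^ J * inverse E) n
      = fps_nth (fps_X ^ J * inverse (euler_inf_fps * euler_inf_fps)) n"
    by (simp add: fps_agree_def)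
  finally show ?thesis
    by (simp add: J_def power2_eq_square)
qed

section \<open>Passage to the sum over all partitions\<close>

lemma partition_in_partitions_upto:
  assumes "is_partition l" "weight l < N"
  shows "l \<in> partitions_upto N"
proof (cases l)
  case (Cons x xs)
  \<comment> \<open>Applied to the parts after the first, this bounds
    \<open>part l 1 + length l\<close> by \<open>sum_list l + 1\<close>.\<close>
  have "length ys \<le> sum_list ys" if "\<forall>y\<in>set ys. 0 < y" for ys :: "nat list"
    using that by (induction ys) auto
  from this[of xs] show ?thesis
    using assms Cons by (auto simp: partitions_upto_def is_partition_def part_def)
qed (auto simp: partitions_upto_def is_partition_def part_def)

theorem theorem5p5:
  fixes j :: int
  shows "((\<lambda>l. of_nat (binom_prod l) * fps_X ^ ((part l 1 choose 2) + sum_list l))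
           has_sum
         (fps_X ^ nat (j * (2 * j - 1)) / (\<Prod>i. (1 - fps_X ^ (2 * (i + 1))) ^ 2) :: rat fps))
         {l. is_partition l \<and> alt_sum l = j}"
proof (rule has_sum_fpsI)
  let ?F = "\<lambda>l. of_nat (binom_prod l) * fps_X ^ weight l :: rat fps"
  fix n
  \<comment> \<open>Coefficients are compared one at a time, so the staircase may depend on
    \<open>n\<close>; this one holds all partitions of weight \<open>n\<close>.\<close>
  define M where "M = Suc (n + nat \<bar>j\<bar>)"
  have F: "fps_nth (?F l) n = (if weight l = n then of_nat (binom_prod l) else 0)" for l
    by (simp add: fps_of_nat[symmetric])
  define L where "L = {l \<in> {l. is_partition l \<and> alt_sum l = j}. fps_nth (?F l) n \<noteq> 0}"
  have sub: "L \<subseteq> {l. l \<in> partitions_upto (2 * M) \<and> alt_sum l = j \<and> weight l = n}" (is "_ \<subseteq> ?L")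
    using partition_in_partitions_upto[of _ "2 * M"]
    by (auto simp: L_def F M_def split: if_splits)
  have fin: "finite ?L" using finite_partitions_upto by simp
  show "finite L" using sub fin by (rule finite_subset)
  have "(\<Sum>l\<in>L. fps_nth (?F l) n) = (\<Sum>l\<in>?L. fps_nth (?F l) n)"
    using fin sub by (rule sum.mono_neutral_left) (auto simp: L_def partitions_upto_def)
  also have "\<dots> = of_nat (\<Sum>l\<in>?L. binom_prod l)"
    unfolding of_nat_sum by (intro sum.cong) (auto simp: F)
  also have "\<dots> = fps_nth (fps_X ^ nat (j * (2 * j - 1)) * inverse (euler_inf_fps ^ 2)) n"
    by (rule sum_binom_prod_eq_fps_nth) (simp add: M_def)
  \<comment> \<open>The denominator has constant term 1, so dividing is multiplying by its
    inverse.\<close>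
  also have "\<dots> = fps_nth (fps_X ^ nat (j * (2 * j - 1)) / (\<Prod>i. (1 - fps_X ^ (2 * (i + 1))) ^ 2)) n"
    unfolding prodinf_euler_squared
    by (subst fps_divide_unit) (simp_all add: euler_inf_fps_nth_0 fps_nth_power_0)
  finally show "fps_nth (fps_X ^ nat (j * (2 * j - 1)) / (\<Prod>i. (1 - fps_X ^ (2 * (i + 1))) ^ 2)) n
      = (\<Sum>l\<in>L. fps_nth (?F l) n)" by simp
qed

end
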